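(* Let $a\in\mathbb R\setminus\mathbb Q$ be a Liouville number, and set $L=\partial_t-a\,\partial_x$ on $\mathbb T^2$. Then, for every $k_1,k_2\in\mathbb R$, there exist $f\in C^\infty(\mathbb T^2)$ and $u\in\mathcal D'(\mathbb T^2)$ such that $$Lu=f\qquad\text{and}\qquad u\notin H_{\mathrm{mix}}^{(k_1,k_2)}(\mathbb T^2).$$
   Context: $\mathbb T=\mathbb R/2\pi\mathbb Z$, with variables $(t,x)\in\mathbb T^2$ and dual frequencies $(\tau,\xi)\in\mathbb Z^2$. $\mathcal D'(\mathbb T^2)$ is the space of distributions on $\mathbb T^2$. Fourier coefficients are $\widehat f(\tau,\xi)=\frac1{(2\pi)^2}\int_{\mathbb T^2}f(t,x)e^{-i(t\tau+x\xi)}\,dt\,dx$ (by duality for distributions). $\langle w\rangle=(1+|w|^2)^{1/2}$. For $s_1,s_2\in\mathbb R$, $H_{\mathrm{mix}}^{(s_1,s_2)}(\mathbb T^2)$ is the space of $f\in\mathcal D'(\mathbb T^2)$ with $\sum_{(\tau,\xi)\in\mathbb Z^2}\langle\tau\rangle^{2s_1}\langle\xi\rangle^{2s_2}|\widehat f(\tau,\xi)|^2<\infty$. The irrationality measure of $a\in\mathbb R\setminus\mathbb Q$ is $\mu(a)=\sup\{\nu>0:\ |a-p/q|<q^{-\nu}\text{ for infinitely many }(p,q)\in\mathbb Z\times\mathbb N\}$; an irrational $a$ is a Liouville number if and only if $\mu(a)=\infty$. *)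

theory Defs
  imports "HOL-Analysis.Analysis" "HOL-Library.Extended_Real"
begin

(* Functions on the torus T^2 = (R / 2 pi Z)^2 are functions of (t,x) in R^2 that are
   2 pi-periodic in each variable. *)

definition periodic2 :: "(real \<times> real \<Rightarrow> complex) \<Rightarrow> bool" where
  "periodic2 f \<longleftrightarrow> (\<forall>t x. f (t + 2 * pi, x) = f (t, x) \<and> f (t, x + 2 * pi) = f (t, x))"

definition partial_t :: "(real \<times> real \<Rightarrow> complex) \<Rightarrow> real \<times> real \<Rightarrow> complex" where
  "partial_t f = (\<lambda>(t, x). vector_derivative (\<lambda>s. f (s, x)) (at t))"

definition partial_x :: "(real \<times> real \<Rightarrow> complex) \<Rightarrow> real \<times> real \<Rightarrow> complex" where
  "partial_x f = (\<lambda>(t, x). vector_derivative (\<lambda>y. f (t, y)) (at x))"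

fun Ck :: "nat \<Rightarrow> (real \<times> real \<Rightarrow> complex) \<Rightarrow> bool" where
  "Ck 0 f \<longleftrightarrow> continuous_on UNIV f"
| "Ck (Suc k) f \<longleftrightarrow>
     continuous_on UNIV f \<and>
     (\<forall>t x. (\<lambda>s. f (s, x)) differentiable (at t) \<and> (\<lambda>y. f (t, y)) differentiable (at x)) \<and>
     Ck k (partial_t f) \<and> Ck k (partial_x f)"

definition smooth_torus :: "(real \<times> real \<Rightarrow> complex) set" where
  "smooth_torus = {f. periodic2 f \<and> (\<forall>k. Ck k f)}"

(* The norms that generate the Frechet topology of C^infinity(T^2). *)
definition Ck_norm :: "nat \<Rightarrow> (real \<times> real \<Rightarrow> complex) \<Rightarrow> real" where
  "Ck_norm N \<phi> = (\<Sum>j\<le>N. \<Sum>k\<le>N - j. SUP z. cmod ((partial_t ^^ j) ((partial_x ^^ k) \<phi>) z))"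

(* D'(T^2): the continuous complex-linear functionals on C^infinity(T^2).  A functional is
   represented by a total HOL function, of which only the values on smooth_torus matter;
   accordingly, equality in D'(T^2) is distr_eq, not HOL equality. *)
definition distributions :: "((real \<times> real \<Rightarrow> complex) \<Rightarrow> complex) set" where
  "distributions = {u.
     (\<forall>\<phi>\<in>smooth_torus. \<forall>\<psi>\<in>smooth_torus. u (\<lambda>z. \<phi> z + \<psi> z) = u \<phi> + u \<psi>) \<and>
     (\<forall>c. \<forall>\<phi>\<in>smooth_torus. u (\<lambda>z. c * \<phi> z) = c * u \<phi>) \<and>
     (\<exists>C N. \<forall>\<phi>\<in>smooth_torus. cmod (u \<phi>) \<le> C * Ck_norm N \<phi>)}"

definition distr_eq ::
    "((real \<times> real \<Rightarrow> complex) \<Rightarrow> complex) \<Rightarrow> ((real \<times> real \<Rightarrow> complex) \<Rightarrow> complex) \<Rightarrow> bool" where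
  "distr_eq u v \<longleftrightarrow> (\<forall>\<phi>\<in>smooth_torus. u \<phi> = v \<phi>)"

definition distr_of :: "(real \<times> real \<Rightarrow> complex) \<Rightarrow> (real \<times> real \<Rightarrow> complex) \<Rightarrow> complex" where
  "distr_of f = (\<lambda>\<phi>. integral (cbox (0, 0) (2 * pi, 2 * pi)) (\<lambda>z. f z * \<phi> z))"

definition distr_partial_t ::
    "((real \<times> real \<Rightarrow> complex) \<Rightarrow> complex) \<Rightarrow> (real \<times> real \<Rightarrow> complex) \<Rightarrow> complex" where
  "distr_partial_t u = (\<lambda>\<phi>. - u (partial_t \<phi>))"

definition distr_partial_x ::
    "((real \<times> real \<Rightarrow> complex) \<Rightarrow> complex) \<Rightarrow> (real \<times> real \<Rightarrow> complex) \<Rightarrow> complex" where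
  "distr_partial_x u = (\<lambda>\<phi>. - u (partial_x \<phi>))"

definition L_op ::
    "real \<Rightarrow> ((real \<times> real \<Rightarrow> complex) \<Rightarrow> complex) \<Rightarrow> (real \<times> real \<Rightarrow> complex) \<Rightarrow> complex" where
  "L_op a u = (\<lambda>\<phi>. distr_partial_t u \<phi> - of_real a * distr_partial_x u \<phi>)"

(* The pairing distr_of is bilinear, without conjugation, so for u = distr_of f this is
   (2 pi)^(-2) times the integral of f(t,x) exp(-i (t tau + x xi)). *)
definition fourier_coeff ::
    "((real \<times> real \<Rightarrow> complex) \<Rightarrow> complex) \<Rightarrow> int \<Rightarrow> int \<Rightarrow> complex" where
  "fourier_coeff u \<tau> \<xi> =
     1 / (2 * of_real pi)^2 * u (\<lambda>(t, x). exp (- \<i> * of_real (t * of_int \<tau> + x * of_int \<xi>)))"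

definition japanese :: "real \<Rightarrow> real" where
  "japanese w = (1 + \<bar>w\<bar>^2) powr (1/2)"

definition H_mix :: "real \<Rightarrow> real \<Rightarrow> ((real \<times> real \<Rightarrow> complex) \<Rightarrow> complex) set" where
  "H_mix s1 s2 = {u \<in> distributions.
     (\<lambda>(\<tau>, \<xi>). japanese (of_int \<tau>) powr (2 * s1) * japanese (of_int \<xi>) powr (2 * s2)
        * (cmod (fourier_coeff u \<tau> \<xi>))^2) summable_on (UNIV :: (int \<times> int) set)}"

definition irrationality_measure :: "real \<Rightarrow> ereal" where
  "irrationality_measure a = Sup {ereal \<nu> | \<nu>. \<nu> > 0 \<and>
     infinite {(p::int, q::nat). q \<ge> 1 \<and> \<bar>a - of_int p / of_nat q\<bar> < of_nat q powr (- \<nu>)}}"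

definition liouville_number :: "real \<Rightarrow> bool" where
  "liouville_number a \<longleftrightarrow> a \<notin> \<rat> \<and> irrationality_measure a = \<infinity>"

end

(* The operator L multiplies exp(i(pt + qx)) by i(p - aq).  As a is a Liouville number there are
   frequencies (p_n, q_n), with q_n strictly increasing and q_n >= 2^n, at which this factor is at
   most q_n^(1-n) in modulus.  Put the coefficient q_n^(2m) at (p_n, q_n), with m at least |k1|
   and |k2|.  The coefficients grow polynomially, so they define a distribution u, but p_n = O(q_n)
   makes their weighted squares bounded below, so u is not in H_mix.  The coefficients of L u decay
   faster than any power of the frequency, so L u is smooth. *)

theory Submission
  imports Defs
begin

section \<open>Smooth functions on the torus\<close>

text \<open>A fixed approximation exponent would gain only a fixed power of q_n, which is not enough
  for smoothness. Exponent \<open>n\<close> at index \<open>n\<close> lets one sequence beat every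
  power after finitely many terms. The bound q_n >= 2^n turns one spare factor 1/q_n into a
  geometric majorant, both for the pairings that define u and for the coefficients of L u. Since u
  is given only by its pairings, L is moved onto the test function: integration by parts against
  each character produces the symbol, and uniform convergence identifies the resulting series with
  the pairing of a smooth function. Continuity of u costs x-derivatives only, because q_n alone
  already tends to infinity fast enough.\<close>

lemma has_vector_derivative_suminf:
  fixes f :: "nat \<Rightarrow> real \<Rightarrow> 'b::banach"
  assumes deriv: "\<And>n x. (f n has_vector_derivative f' n x) (at x)"
    and bound: "\<And>n x. norm (f' n x) \<le> M n"
    and "summable M" and summable: "\<And>x. summable (\<lambda>n. f n x)"
  shows "((\<lambda>x. \<Sum>n. f n x) has_vector_derivative (\<Sum>n. f' n x)) (at x)"
proof -
  have "uniform_limit UNIV (\<lambda>n x. \<Sum>i<n. f' i x) (\<lambda>x. \<Sum>i. f' i x) sequentially"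
    using bound \<open>summable M\<close> by (intro Weierstrass_m_test) auto
  then have unif: "\<forall>\<^sub>F n in sequentially. \<forall>x. norm ((\<Sum>i<n. f' i x) - (\<Sum>i. f' i x)) < e"
    if "e > 0" for e
    using that by (simp add: uniform_limit_iff dist_norm)
  have "\<exists>g. \<forall>x\<in>UNIV. (\<lambda>n. f n x) sums g x \<and>
      (g has_derivative (\<lambda>h. h *\<^sub>R (\<Sum>i. f' i x))) (at x within UNIV)"
  proof (rule has_derivative_series)
    show "(f n has_derivative (\<lambda>h. h *\<^sub>R f' n x)) (at x within UNIV)" for n x
      using deriv[of n x] by (simp add: has_vector_derivative_def)
    \<comment> \<open>Scaling a fixed vector \<open>v\<close> by \<open>h\<close> is a linear map of
      norm \<open>norm v\<close>, so uniform closeness of the derivatives is uniform closeness of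
      the linear maps.\<close>
    show "\<forall>\<^sub>F n in sequentially. \<forall>x\<in>UNIV. \<forall>h.
        norm ((\<Sum>i<n. h *\<^sub>R f' i x) - h *\<^sub>R (\<Sum>i. f' i x)) \<le> e * norm h" if "e > 0" for e
      using unif[OF that]
    proof eventually_elim
      case (elim n)
      have "norm ((\<Sum>i<n. h *\<^sub>R f' i x) - h *\<^sub>R (\<Sum>i. f' i x)) \<le> e * norm h" for x h
      proof -
        have "(\<Sum>i<n. h *\<^sub>R f' i x) - h *\<^sub>R (\<Sum>i. f' i x)
            = h *\<^sub>R ((\<Sum>i<n. f' i x) - (\<Sum>i. f' i x))"
          by (simp add: scaleR_diff_right scaleR_sum_right)
        then show ?thesis
          using elim[rule_format, of x] by (auto simp: mult.commute[of e] intro!: mult_left_mono)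
      qed
      then show ?case by blast
    qed
    show "(\<lambda>n. f n 0) sums (\<Sum>n. f n 0)"
      using summable by (rule summable_sums)
  qed auto
  then obtain g where "\<And>x. (\<lambda>n. f n x) sums g x"
    and g: "\<And>x. (g has_derivative (\<lambda>h. h *\<^sub>R (\<Sum>i. f' i x))) (at x)"
    by auto
  then have "g = (\<lambda>x. \<Sum>n. f n x)"
    by (auto simp: sums_iff)
  then show ?thesis
    using g[of x] by (simp add: has_vector_derivative_def)
qed

lemma smooth_torus_continuous: "\<phi> \<in> smooth_torus \<Longrightarrow> continuous_on S \<phi>"
proof -
  assume "\<phi> \<in> smooth_torus"
  then have "Ck 0 \<phi>" unfolding smooth_torus_def by blast
  then show ?thesis using continuous_on_subset by auto
qed

lemma smooth_torus_has_partial: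
  assumes "\<phi> \<in> smooth_torus"
  shows "((\<lambda>s. \<phi> (s, x)) has_vector_derivative partial_t \<phi> (t, x)) (at t)"
    and "((\<lambda>y. \<phi> (t, y)) has_vector_derivative partial_x \<phi> (t, x)) (at x)"
proof -
  have "Ck (Suc 0) \<phi>" using assms unfolding smooth_torus_def by blast
  then show "((\<lambda>s. \<phi> (s, x)) has_vector_derivative partial_t \<phi> (t, x)) (at t)"
    and "((\<lambda>y. \<phi> (t, y)) has_vector_derivative partial_x \<phi> (t, x)) (at x)"
    by (auto simp: partial_t_def partial_x_def vector_derivative_works)
qed

text \<open>\<open>Ck (Suc k)\<close> hands \<open>Ck k\<close> to both derivatives by definition,
  so only periodicity needs an argument: the chain rule and uniqueness of derivatives in the
  differentiated variable, plain rewriting in the other.\<close>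

lemma smooth_torus_partial:
  assumes "\<phi> \<in> smooth_torus"
  shows "partial_t \<phi> \<in> smooth_torus" and "partial_x \<phi> \<in> smooth_torus"
proof -
  have per: "\<phi> (t + 2 * pi, x) = \<phi> (t, x)" "\<phi> (t, x + 2 * pi) = \<phi> (t, x)" for t x
    using assms by (auto simp: smooth_torus_def periodic2_def)
  have Ck: "Ck (Suc k) \<phi>" for k
    using assms unfolding smooth_torus_def by blast
  have "((\<lambda>s. \<phi> (s + 2 * pi, x)) has_vector_derivative partial_t \<phi> (t + 2 * pi, x)) (at t)" for t x
    using vector_diff_chain_at[OF _ smooth_torus_has_partial(1)[OF assms],
        of "\<lambda>s. s + 2 * pi" 1 t x]
    by (simp add: o_def has_vector_derivative_add_const)
  then have "partial_t \<phi> (t + 2 * pi, x) = partial_t \<phi> (t, x)" for t x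
    unfolding per using vector_derivative_at smooth_torus_has_partial(1)[OF assms] by metis
  moreover have "partial_t \<phi> (t, x + 2 * pi) = partial_t \<phi> (t, x)" for t x
    by (simp add: partial_t_def per)
  ultimately show "partial_t \<phi> \<in> smooth_torus"
    using Ck by (auto simp: smooth_torus_def periodic2_def)
  have "((\<lambda>y. \<phi> (t, y + 2 * pi)) has_vector_derivative partial_x \<phi> (t, x + 2 * pi)) (at x)" for t x
    using vector_diff_chain_at[OF _ smooth_torus_has_partial(2)[OF assms],
        of "\<lambda>y. y + 2 * pi" 1 x t]
    by (simp add: o_def has_vector_derivative_add_const)
  then have "partial_x \<phi> (t, x + 2 * pi) = partial_x \<phi> (t, x)" for t x
    unfolding per using vector_derivative_at smooth_torus_has_partial(2)[OF assms] by metis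
  moreover have "partial_x \<phi> (t + 2 * pi, x) = partial_x \<phi> (t, x)" for t x
    by (simp add: partial_x_def per)
  ultimately show "partial_x \<phi> \<in> smooth_torus"
    using Ck by (auto simp: smooth_torus_def periodic2_def)
qed

lemma smooth_torus_iterated_partial:
  assumes "\<phi> \<in> smooth_torus"
  shows "(partial_t ^^ j) ((partial_x ^^ k) \<phi>) \<in> smooth_torus"
proof -
  have "(partial_x ^^ k) \<phi> \<in> smooth_torus"
    by (induction k) (auto simp: assms smooth_torus_partial)
  then show ?thesis
    by (induction j) (auto simp: smooth_torus_partial)
qed

lemma periodic_shift_int:
  fixes f :: "real \<Rightarrow> 'b"
  assumes "\<And>x. f (x + c) = f x"
  shows "f (x + of_int n * c) = f x"
proof (induction n rule: int_induct[where k = 0])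
  case (step1 i)
  then show ?case using assms[of "x + of_int i * c"] by (simp add: algebra_simps)
next
  case (step2 i)
  then show ?case using assms[of "x + of_int (i - 1) * c"] by (simp add: algebra_simps)
qed simp

text \<open>Periodicity brings every value into the image of a compact square. Boundedness is what
  makes the real suprema in \<open>Ck_norm\<close> genuine upper bounds.\<close>

lemma smooth_torus_bounded:
  assumes "\<phi> \<in> smooth_torus"
  shows "bounded (range \<phi>)"
proof -
  let ?B = "cbox (0, 0) (2 * pi, 2 * pi)"
  have per: "\<phi> (t + 2 * pi, x) = \<phi> (t, x)" "\<phi> (t, x + 2 * pi) = \<phi> (t, x)" for t x
    using assms by (auto simp: smooth_torus_def periodic2_def)
  have red: "\<exists>m::int. 0 \<le> r + of_int m * (2 * pi) \<and> r + of_int m * (2 * pi) \<le> 2 * pi" for r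
  proof (intro exI[of _ "- \<lfloor>r / (2 * pi)\<rfloor>"] conjI)
    have "of_int \<lfloor>r / (2 * pi)\<rfloor> \<le> r / (2 * pi)" "r / (2 * pi) \<le> of_int \<lfloor>r / (2 * pi)\<rfloor> + 1"
      by linarith+
    then have "of_int \<lfloor>r / (2 * pi)\<rfloor> * (2 * pi) \<le> r"
        "r \<le> (of_int \<lfloor>r / (2 * pi)\<rfloor> + 1) * (2 * pi)"
      by (simp_all only: pos_le_divide_eq pos_divide_le_eq pi_gt_zero zero_less_mult_iff zero_less_numeral simp_thms)
    then show "0 \<le> r + of_int (- \<lfloor>r / (2 * pi)\<rfloor>) * (2 * pi)"
        "r + of_int (- \<lfloor>r / (2 * pi)\<rfloor>) * (2 * pi) \<le> 2 * pi"
      by (simp_all add: algebra_simps)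
  qed
  have "\<phi> z \<in> \<phi> ` ?B" for z
  proof -
    obtain t x where z: "z = (t, x)" by force
    obtain m n :: int where
      "0 \<le> t + of_int m * (2 * pi)" "t + of_int m * (2 * pi) \<le> 2 * pi"
      "0 \<le> x + of_int n * (2 * pi)" "x + of_int n * (2 * pi) \<le> 2 * pi"
      using red[of t] red[of x] by blast
    moreover have "\<phi> (t + of_int m * (2 * pi), x + of_int n * (2 * pi)) = \<phi> (t, x)"
      using periodic_shift_int[of "\<lambda>s. \<phi> (s, x + of_int n * (2 * pi))" "2 * pi" t m]
        periodic_shift_int[of "\<lambda>y. \<phi> (t, y)" "2 * pi" x n] by (simp add: per)
    ultimately show ?thesis
      unfolding z by (intro image_eqI[where x = "(t + of_int m * (2 * pi), x + of_int n * (2 * pi))"])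
        (auto simp: cbox_Pair_eq)
  qed
  then have "range \<phi> \<subseteq> \<phi> ` ?B" by blast
  moreover have "compact (\<phi> ` ?B)"
    by (intro compact_continuous_image smooth_torus_continuous assms compact_cbox)
  ultimately show ?thesis
    using bounded_subset compact_imp_bounded by blast
qed

text \<open>The summand with \<open>j = 0\<close> and \<open>k = M\<close> already dominates, and
  the other summands are nonnegative.\<close>

lemma norm_partial_x_le_Ck_norm:
  assumes "\<phi> \<in> smooth_torus"
  shows "cmod ((partial_x ^^ M) \<phi> z) \<le> Ck_norm M \<phi>"
proof -
  define S where "S = (\<lambda>j k. SUP z. cmod ((partial_t ^^ j) ((partial_x ^^ k) \<phi>) z))"
  have le_S: "cmod ((partial_t ^^ j) ((partial_x ^^ k) \<phi>) z) \<le> S j k" for j k z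
    unfolding S_def
  proof (rule cSUP_upper)
    have "bounded (range (\<lambda>z. (partial_t ^^ j) ((partial_x ^^ k) \<phi>) z))"
      by (intro smooth_torus_bounded smooth_torus_iterated_partial assms)
    then show "bdd_above (range (\<lambda>z. cmod ((partial_t ^^ j) ((partial_x ^^ k) \<phi>) z)))"
      by (auto simp: bounded_iff bdd_above_def)
  qed simp
  then have S_nonneg: "0 \<le> S j k" for j k
    using norm_ge_zero order_trans by blast
  have "cmod ((partial_x ^^ M) \<phi> z) \<le> S 0 M"
    using le_S[of 0 M z] by simp
  also have "\<dots> \<le> (\<Sum>k\<le>M - 0. S 0 k)"
    by (rule member_le_sum) (auto simp: S_nonneg)
  also have "\<dots> \<le> (\<Sum>j\<le>M. \<Sum>k\<le>M - j. S j k)"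
    by (rule member_le_sum[where f = "\<lambda>j. \<Sum>k\<le>M - j. S j k"])
      (auto simp: S_nonneg intro!: sum_nonneg)
  finally show ?thesis
    by (simp add: Ck_norm_def S_def)
qed

section \<open>Trigonometric series\<close>

definition character :: "int \<Rightarrow> int \<Rightarrow> real \<times> real \<Rightarrow> complex" where
  "character p q = (\<lambda>(t, x). exp (\<i> * of_real (t * of_int p + x * of_int q)))"

definition trig_series ::
    "(nat \<Rightarrow> complex) \<Rightarrow> (nat \<Rightarrow> int) \<Rightarrow> (nat \<Rightarrow> int) \<Rightarrow> real \<times> real \<Rightarrow> complex" where
  "trig_series c p q = (\<lambda>z. \<Sum>n. c n * character (p n) (q n) z)"

text \<open>Summability against every power feeds the M-test directly and is stable under
  differentiation. The frequencies may repeat.\<close>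

definition rapidly_decreasing :: "(nat \<Rightarrow> complex) \<Rightarrow> (nat \<Rightarrow> int) \<Rightarrow> (nat \<Rightarrow> int) \<Rightarrow> bool" where
  "rapidly_decreasing c p q \<longleftrightarrow>
     (\<forall>k. summable (\<lambda>n. cmod (c n) * (1 + \<bar>of_int (p n)\<bar> + \<bar>of_int (q n)\<bar>) ^ k))"

lemma norm_character [simp]: "cmod (character p q z) = 1"
  by (cases z) (simp add: character_def)

lemma continuous_on_character [continuous_intros]: "continuous_on S (character p q)"
  unfolding character_def case_prod_unfold by (intro continuous_intros)

lemma periodic_character:
  "character p q (t + 2 * pi, x) = character p q (t, x)"
  "character p q (t, x + 2 * pi) = character p q (t, x)"
proof -
  have *: "exp (2 * pi * of_int n * \<i>) = 1" for n :: int
    using exp_integer_2pi[of "of_int n"] by (simp add: mult_ac)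
  show "character p q (t + 2 * pi, x) = character p q (t, x)"
    "character p q (t, x + 2 * pi) = character p q (t, x)"
    using *[of p] *[of q] by (simp_all add: character_def algebra_simps exp_add)
qed

lemma has_vector_derivative_character:
  "((\<lambda>s. character p q (s, x)) has_vector_derivative \<i> * of_int p * character p q (t, x)) (at t)"
  "((\<lambda>y. character p q (t, y)) has_vector_derivative \<i> * of_int q * character p q (t, x)) (at x)"
proof -
  have "((\<lambda>s. exp (\<i> * (s * of_int p + of_real x * of_int q))) has_field_derivative
      \<i> * of_int p * character p q (t, x)) (at (of_real t))"
    by (rule derivative_eq_intros refl)+ (simp add: character_def mult_ac)
  from has_vector_derivative_real_field[OF this]
  show "((\<lambda>s. character p q (s, x)) has_vector_derivative \<i> * of_int p * character p q (t, x)) (at t)"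
    by (simp add: character_def)
  have "((\<lambda>y. exp (\<i> * (of_real t * of_int p + y * of_int q))) has_field_derivative
      \<i> * of_int q * character p q (t, x)) (at (of_real x))"
    by (rule derivative_eq_intros refl)+ (simp add: character_def mult_ac)
  from has_vector_derivative_real_field[OF this]
  show "((\<lambda>y. character p q (t, y)) has_vector_derivative \<i> * of_int q * character p q (t, x)) (at x)"
    by (simp add: character_def)
qed

lemma rapidly_decreasing_summable:
  assumes "rapidly_decreasing c p q"
  shows "summable (\<lambda>n. cmod (c n))"
  using assms[unfolded rapidly_decreasing_def, rule_format, of 0] by simp

text \<open>This is closure under differentiation, used with \<open>d n\<close> equal to i times a
  component of the frequency. The extra factor costs one power of the weight.\<close>

lemma rapidly_decreasing_times:
  assumes "rapidly_decreasing c p q" and "\<And>n. cmod (d n) \<le> 1 + \<bar>of_int (p n)\<bar> + \<bar>of_int (q n)\<bar>"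
  shows "rapidly_decreasing (\<lambda>n. d n * c n) p q"
  unfolding rapidly_decreasing_def
proof
  fix k
  let ?w = "\<lambda>n. 1 + \<bar>real_of_int (p n)\<bar> + \<bar>of_int (q n)\<bar>"
  show "summable (\<lambda>n. cmod (d n * c n) * ?w n ^ k)"
  proof (rule summable_comparison_test')
    show "summable (\<lambda>n. cmod (c n) * ?w n ^ Suc k)"
      using assms(1) unfolding rapidly_decreasing_def by blast
    have "cmod (d n) * (cmod (c n) * ?w n ^ k) \<le> ?w n * (cmod (c n) * ?w n ^ k)" for n
      by (intro mult_right_mono assms(2)) auto
    then show "norm (cmod (d n * c n) * ?w n ^ k) \<le> cmod (c n) * ?w n ^ Suc k" for n
      by (simp add: norm_mult abs_mult algebra_simps)
  qed
qed

lemma trig_series_summable: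
  "rapidly_decreasing c p q \<Longrightarrow> summable (\<lambda>n. c n * character (p n) (q n) z)"
  by (rule summable_norm_cancel) (simp add: norm_mult rapidly_decreasing_summable)

lemma trig_series_uniform_limit:
  assumes "rapidly_decreasing c p q"
  shows "uniform_limit S (\<lambda>n z. \<Sum>i<n. c i * character (p i) (q i) z) (trig_series c p q) sequentially"
  unfolding trig_series_def
  by (rule Weierstrass_m_test[OF _ rapidly_decreasing_summable[OF assms]]) (simp add: norm_mult)

lemma continuous_on_trig_series:
  assumes "rapidly_decreasing c p q"
  shows "continuous_on S (trig_series c p q)"
  by (rule uniform_limit_theorem[OF _ trig_series_uniform_limit[OF assms]])
    (auto intro!: always_eventually continuous_intros)

lemma trig_series_partial:
  assumes "rapidly_decreasing c p q"
  shows "((\<lambda>s. trig_series c p q (s, x)) has_vector_derivative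
           trig_series (\<lambda>n. \<i> * of_int (p n) * c n) p q (t, x)) (at t)" (is ?T)
    and "((\<lambda>y. trig_series c p q (t, y)) has_vector_derivative
           trig_series (\<lambda>n. \<i> * of_int (q n) * c n) p q (t, x)) (at x)" (is ?X)
proof -
  have p: "rapidly_decreasing (\<lambda>n. \<i> * of_int (p n) * c n) p q"
    and q: "rapidly_decreasing (\<lambda>n. \<i> * of_int (q n) * c n) p q"
    by (auto intro!: rapidly_decreasing_times assms simp: norm_mult)
  have t: "((\<lambda>s. c n * character (p n) (q n) (s, x)) has_vector_derivative
      \<i> * of_int (p n) * c n * character (p n) (q n) (t, x)) (at t)" for n t x
    using has_vector_derivative_mult_right[OF has_vector_derivative_character(1)[of "p n" "q n" x t], of "c n"]
    by (simp add: mult_ac)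
  have x: "((\<lambda>y. c n * character (p n) (q n) (t, y)) has_vector_derivative
      \<i> * of_int (q n) * c n * character (p n) (q n) (t, x)) (at x)" for n t x
    using has_vector_derivative_mult_right[OF has_vector_derivative_character(2)[of "p n" "q n" t x], of "c n"]
    by (simp add: mult_ac)
  show ?T
    unfolding trig_series_def
    by (rule has_vector_derivative_suminf[OF t _ rapidly_decreasing_summable[OF p]
          trig_series_summable[OF assms]]) (simp add: norm_mult)
  show ?X
    unfolding trig_series_def
    by (rule has_vector_derivative_suminf[OF x _ rapidly_decreasing_summable[OF q]
          trig_series_summable[OF assms]]) (simp add: norm_mult)
qed

lemma partial_trig_series:
  assumes "rapidly_decreasing c p q"
  shows "partial_t (trig_series c p q) = trig_series (\<lambda>n. \<i> * of_int (p n) * c n) p q"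
    and "partial_x (trig_series c p q) = trig_series (\<lambda>n. \<i> * of_int (q n) * c n) p q"
  using trig_series_partial[OF assms]
  by (auto simp: fun_eq_iff partial_t_def partial_x_def vector_derivative_at)

text \<open>Both partial derivatives are again rapidly decreasing series over the same frequencies,
  so the induction on the order keeps the coefficients arbitrary.\<close>

lemma trig_series_smooth:
  assumes "rapidly_decreasing c p q"
  shows "trig_series c p q \<in> smooth_torus"
proof -
  have "Ck k (trig_series c p q)" for k
    using assms
  proof (induction k arbitrary: c)
    case 0
    then show ?case by (simp add: continuous_on_trig_series)
  next
    case (Suc k)
    have "rapidly_decreasing (\<lambda>n. \<i> * of_int (p n) * c n) p q"
      "rapidly_decreasing (\<lambda>n. \<i> * of_int (q n) * c n) p q"
      by (auto intro!: rapidly_decreasing_times Suc.prems simp: norm_mult)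
    then show ?case
      using Suc.IH trig_series_partial[OF Suc.prems, THEN differentiableI_vector]
      by (simp add: partial_trig_series continuous_on_trig_series Suc.prems)
  qed
  moreover have "periodic2 (trig_series c p q)"
    by (simp add: periodic2_def trig_series_def periodic_character)
  ultimately show ?thesis
    by (simp add: smooth_torus_def)
qed

text \<open>A character is a series with one nonzero coefficient along a constant frequency
  sequence.\<close>

lemma character_smooth: "character p q \<in> smooth_torus"
proof -
  let ?c = "\<lambda>n. if n = 0 then 1 else 0 :: complex"
  have "rapidly_decreasing ?c (\<lambda>_. p) (\<lambda>_. q)"
    unfolding rapidly_decreasing_def by (auto intro!: summable_finite[of "{0}"] split: if_splits)
  moreover have "trig_series ?c (\<lambda>_. p) (\<lambda>_. q) = character p q"
  proof
    show "trig_series ?c (\<lambda>_. p) (\<lambda>_. q) z = character p q z" for z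
      using suminf_finite[of "{0}" "\<lambda>n. ?c n * character p q z"] by (simp add: trig_series_def)
  qed
  ultimately show ?thesis
    using trig_series_smooth by metis
qed

section \<open>Pairing with characters\<close>

lemma partial_character:
  "partial_t (character p q) = (\<lambda>z. \<i> * of_int p * character p q z)"
  "partial_x (character p q) = (\<lambda>z. \<i> * of_int q * character p q z)"
  using has_vector_derivative_character[THEN vector_derivative_at]
  by (auto simp: fun_eq_iff partial_t_def partial_x_def)

lemma integral_periodic_derivative:
  fixes F :: "real \<Rightarrow> complex"
  assumes "\<And>x. (F has_vector_derivative F' x) (at x)" and "F (2 * pi) = F 0"
  shows "integral (cbox 0 (2 * pi)) F' = 0"
proof -
  have "(F' has_integral F (2 * pi) - F 0) {0..2 * pi}"
    by (rule fundamental_theorem_of_calculus)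
      (auto intro: has_vector_derivative_at_within assms)
  then show ?thesis
    using assms(2) by (simp add: integral_unique)
qed

text \<open>Integration by parts on the square; the boundary terms cancel by periodicity.\<close>

lemma distr_of_character_partial:
  assumes "\<phi> \<in> smooth_torus"
  shows "distr_of (character p q) (partial_t \<phi>) = - (\<i> * of_int p) * distr_of (character p q) \<phi>"
    and "distr_of (character p q) (partial_x \<phi>) = - (\<i> * of_int q) * distr_of (character p q) \<phi>"
proof -
  let ?B = "cbox (0, 0) (2 * pi, 2 * pi)"
  let ?e = "character p q"
  have per: "\<phi> (2 * pi, x) = \<phi> (0, x)" "\<phi> (t, 2 * pi) = \<phi> (t, 0)" for t x
    using assms by (auto simp: smooth_torus_def periodic2_def dest: spec[of _ 0]) (metis add_0)+
  have per': "?e (2 * pi, x) = ?e (0, x)" "?e (t, 2 * pi) = ?e (t, 0)" for t x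
    using periodic_character[of p q 0 x] periodic_character[of p q t 0] by simp_all
  note cont [continuous_intros] = assms[THEN smooth_torus_continuous]
    assms[THEN smooth_torus_partial(1), THEN smooth_torus_continuous]
    assms[THEN smooth_torus_partial(2), THEN smooth_torus_continuous]
  have int: "(\<lambda>z. ?e z * \<psi> z) integrable_on ?B" if "continuous_on ?B \<psi>" for \<psi> :: "real \<times> real \<Rightarrow> complex"
    by (intro integrable_continuous continuous_intros that)
  \<comment> \<open>By the product rule, \<open>Gt\<close> and \<open>Gx\<close> are the partial
    derivatives of the product of \<open>?e\<close> with the test function.\<close>
  define Gt where "Gt = (\<lambda>z. ?e z * partial_t \<phi> z + \<i> * of_int p * (?e z * \<phi> z))"
  define Gx where "Gx = (\<lambda>z. ?e z * partial_x \<phi> z + \<i> * of_int q * (?e z * \<phi> z))"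
  have cont_G: "continuous_on S Gt" "continuous_on S Gx" for S
    unfolding Gt_def Gx_def by (intro continuous_intros)+
  have Gt: "integral (cbox 0 (2 * pi)) (\<lambda>t. Gt (t, x)) = 0" for x
  proof (rule integral_periodic_derivative)
    show "((\<lambda>t. ?e (t, x) * \<phi> (t, x)) has_vector_derivative Gt (t, x)) (at t)" for t
      using has_vector_derivative_mult[OF has_vector_derivative_character(1)[of p q x t]
          smooth_torus_has_partial(1)[OF assms, of x t]]
      by (simp add: Gt_def algebra_simps)
  qed (simp add: per per')
  have Gx: "integral (cbox 0 (2 * pi)) (\<lambda>x. Gx (t, x)) = 0" for t
  proof (rule integral_periodic_derivative)
    show "((\<lambda>x. ?e (t, x) * \<phi> (t, x)) has_vector_derivative Gx (t, x)) (at x)" for x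
      using has_vector_derivative_mult[OF has_vector_derivative_character(2)[of p q t x]
          smooth_torus_has_partial(2)[OF assms, of t x]]
      by (simp add: Gx_def algebra_simps)
  qed (simp add: per per')
  \<comment> \<open>The iterated integral comes with x as the inner variable. \<open>Gt\<close>
    integrates to zero in t, so the order is swapped here; \<open>Gx\<close> can do without a
    swap.\<close>
  have "integral ?B Gt = integral (cbox 0 (2 * pi)) (\<lambda>t. integral (cbox 0 (2 * pi)) (\<lambda>x. Gt (t, x)))"
    by (rule integral_prod_continuous[OF cont_G(1)])
  also have "\<dots> = integral (cbox 0 (2 * pi)) (\<lambda>x. integral (cbox 0 (2 * pi)) (\<lambda>t. Gt (t, x)))"
    by (rule integral_swap_continuous) (simp add: cont_G)
  finally have "integral ?B Gt = 0"
    by (simp only: Gt integral_0)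
  moreover have "integral ?B Gt = distr_of ?e (partial_t \<phi>) + \<i> * of_int p * distr_of ?e \<phi>"
    unfolding Gt_def distr_of_def
    by (subst integral_add) (auto intro!: int continuous_intros integrable_on_mult_right)
  ultimately show "distr_of ?e (partial_t \<phi>) = - (\<i> * of_int p) * distr_of ?e \<phi>"
    by (simp add: eq_neg_iff_add_eq_0)
  have "integral ?B Gx = 0"
    using integral_prod_continuous[OF cont_G(2)] by (simp only: Gx integral_0)
  moreover have "integral ?B Gx = distr_of ?e (partial_x \<phi>) + \<i> * of_int q * distr_of ?e \<phi>"
    unfolding Gx_def distr_of_def
    by (subst integral_add) (auto intro!: int continuous_intros integrable_on_mult_right)
  ultimately show "distr_of ?e (partial_x \<phi>) = - (\<i> * of_int q) * distr_of ?e \<phi>"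
    by (simp add: eq_neg_iff_add_eq_0)
qed

lemma distr_of_add:
  assumes "f \<in> smooth_torus" "\<phi> \<in> smooth_torus" "\<psi> \<in> smooth_torus"
  shows "distr_of f (\<lambda>z. \<phi> z + \<psi> z) = distr_of f \<phi> + distr_of f \<psi>"
  unfolding distr_of_def distrib_left
  by (intro integral_add integrable_continuous continuous_intros smooth_torus_continuous assms)

lemma distr_of_cmult: "distr_of f (\<lambda>z. c * \<phi> z) = c * distr_of f \<phi>"
  using integral_mult_right[of _ c "\<lambda>z. f z * \<phi> z"]
  by (simp add: distr_of_def mult.left_commute)

text \<open>The pairing has no conjugation, so it is opposite frequencies that match. Off the
  diagonal no integral is evaluated: moving a derivative from one factor to the other shows that
  \<open>p + p'\<close> and \<open>q + q'\<close> both annihilate the pairing.\<close>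

lemma distr_of_characters:
  "distr_of (character p q) (character p' q') = (if p + p' = 0 \<and> q + q' = 0 then (2 * of_real pi)^2 else 0)"
proof (cases "p + p' = 0 \<and> q + q' = 0")
  case True
  then have "p' = - p" "q' = - q" by auto
  then have "character p q z * character p' q' z = 1" for z
    by (cases z) (simp add: character_def algebra_simps flip: exp_add)
  then show ?thesis
    using True by (simp add: distr_of_def content_Pair power2_eq_square scaleR_conv_of_real)
next
  case False
  have "\<i> * of_int p' * distr_of (character p q) (character p' q')
      = - (\<i> * of_int p) * distr_of (character p q) (character p' q')"
    "\<i> * of_int q' * distr_of (character p q) (character p' q')
      = - (\<i> * of_int q) * distr_of (character p q) (character p' q')"
    using distr_of_character_partial[OF character_smooth, of p q p' q']
    by (simp_all only: partial_character distr_of_cmult)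
  then have "(\<i> * of_int (p + p')) * distr_of (character p q) (character p' q') = 0"
    "(\<i> * of_int (q + q')) * distr_of (character p q) (character p' q') = 0"
    by (simp_all add: algebra_simps)
  then show ?thesis
    using False by (simp add: of_int_eq_0_iff del: of_int_add) (metis of_int_eq_0_iff)
qed

text \<open>Each x-derivative on the test function yields one factor \<open>q\<close> in modulus.
  After \<open>M\<close> of them the integrand is at most \<open>Ck_norm M\<close>, on a square of
  area (2 pi)^2.\<close>

lemma norm_distr_of_character_le:
  assumes "\<phi> \<in> smooth_torus"
  shows "\<bar>of_int q\<bar> ^ M * cmod (distr_of (character p q) \<phi>) \<le> (2 * pi)^2 * Ck_norm M \<phi>"
proof -
  let ?\<psi> = "(partial_x ^^ M) \<phi>"
  have smooth: "(partial_x ^^ k) \<phi> \<in> smooth_torus" for k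
    using smooth_torus_iterated_partial[OF assms, of 0 k] by simp
  have "distr_of (character p q) ((partial_x ^^ k) \<phi>)
      = (- (\<i> * of_int q)) ^ k * distr_of (character p q) \<phi>" for k
    by (induction k) (simp_all add: distr_of_character_partial smooth)
  then have "\<bar>of_int q\<bar> ^ M * cmod (distr_of (character p q) \<phi>) = cmod (distr_of (character p q) ?\<psi>)"
    by (simp add: norm_mult norm_power)
  also have "\<dots> \<le> integral (cbox (0, 0) (2 * pi, 2 * pi)) (\<lambda>_. Ck_norm M \<phi>)"
    unfolding distr_of_def
    by (rule integral_norm_bound_integral)
      (auto simp: norm_mult norm_partial_x_le_Ck_norm[OF assms]
        intro!: integrable_continuous continuous_on_mult continuous_on_character
          smooth_torus_continuous[OF smooth])
  also have "\<dots> = (2 * pi)^2 * Ck_norm M \<phi>"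
    by (simp add: content_Pair power2_eq_square)
  finally show ?thesis .
qed

text \<open>Uniform convergence survives multiplication by the bounded test function and passes
  through the integral over the compact square.\<close>

lemma distr_of_trig_series:
  assumes "rapidly_decreasing c p q" and "\<phi> \<in> smooth_torus"
  shows "distr_of (trig_series c p q) \<phi> = (\<Sum>n. c n * distr_of (character (p n) (q n)) \<phi>)"
proof -
  let ?B = "cbox (0, 0) (2 * pi, 2 * pi)"
  let ?f = "\<lambda>n z. \<Sum>i<n. c i * character (p i) (q i) z"
  note smooth_torus_continuous[OF assms(2), continuous_intros]
  have "uniform_limit ?B (\<lambda>n z. ?f n z * \<phi> z) (\<lambda>z. trig_series c p q z * \<phi> z) sequentially"
  proof (rule uniform_lim_mult[OF trig_series_uniform_limit[OF assms(1)] uniform_limit_const])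
    show "bounded (trig_series c p q ` ?B)"
      by (meson trig_series_smooth[OF assms(1)] smooth_torus_bounded bounded_subset image_mono subset_UNIV)
    show "bounded (\<phi> ` ?B)"
      by (meson smooth_torus_bounded[OF assms(2)] bounded_subset image_mono subset_UNIV)
  qed
  then obtain I J where I: "\<And>n. ((\<lambda>z. ?f n z * \<phi> z) has_integral I n) ?B"
    and J: "((\<lambda>z. trig_series c p q z * \<phi> z) has_integral J) ?B" and "I \<longlonglongrightarrow> J"
    by (rule uniform_limit_integral_cbox) (auto intro!: continuous_intros)
  have "I n = (\<Sum>i<n. c i * distr_of (character (p i) (q i)) \<phi>)" for n
  proof -
    have "((\<lambda>z. \<Sum>i<n. c i * (character (p i) (q i) z * \<phi> z)) has_integral
        (\<Sum>i<n. c i * distr_of (character (p i) (q i)) \<phi>)) ?B"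
      unfolding distr_of_def
      by (intro has_integral_sum has_integral_mult_right integrable_integral
          integrable_continuous continuous_intros) auto
    then show ?thesis
      using I[of n] by (simp add: sum_distrib_right mult.assoc has_integral_unique)
  qed
  then have "(\<lambda>n. c n * distr_of (character (p n) (q n)) \<phi>) sums J"
    using \<open>I \<longlonglongrightarrow> J\<close> by (metis (no_types, lifting) ext sums_def)
  then show ?thesis
    using J by (simp add: distr_of_def sums_iff integral_unique)
qed

section \<open>Liouville numbers\<close>

text \<open>The definition supplies infinitely many good pairs but says nothing about the size of
  \<open>q\<close>. If all of them had \<open>q <= B\<close>, closeness to \<open>a\<close> would
  bound the numerators too, leaving finitely many pairs.\<close>

lemma liouville_approximation:
  assumes "liouville_number a"
  shows "\<exists>(p::int) (q::nat). B < q \<and> \<bar>a - of_int p / of_nat q\<bar> * of_nat q ^ n < 1"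
proof (rule ccontr)
  assume contra: "\<not> ?thesis"
  have "ereal (real n) < irrationality_measure a"
    using assms by (simp add: liouville_number_def)
  then obtain \<nu> where "\<nu> > real n"
    and inf: "infinite {(p::int, q::nat). q \<ge> 1 \<and> \<bar>a - of_int p / of_nat q\<bar> < of_nat q powr (- \<nu>)}"
    by (auto simp: irrationality_measure_def less_Sup_iff)
  \<comment> \<open>A good pair satisfies |p/q| <= |a| + 1, hence |p| <= (|a| + 1) B once
    \<open>q <= B\<close>.\<close>
  let ?K = "\<lceil>(\<bar>a\<bar> + 1) * of_nat B\<rceil>"
  have "p \<in> {- ?K..?K} \<and> q \<le> B"
    if "q \<ge> 1" and less: "\<bar>a - of_int p / of_nat q\<bar> < of_nat q powr (- \<nu>)" for p :: int and q :: nat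
  proof -
    have "of_nat q powr (- \<nu>) \<le> of_nat q powr (- real n)"
      using \<open>q \<ge> 1\<close> \<open>\<nu> > real n\<close> by (intro powr_mono) auto
    also have "\<dots> = inverse (of_nat q ^ n)"
      using \<open>q \<ge> 1\<close> by (simp add: powr_minus powr_realpow)
    finally have *: "\<bar>a - of_int p / of_nat q\<bar> < inverse (of_nat q ^ n)"
      using less by simp
    then have "\<bar>a - of_int p / of_nat q\<bar> * of_nat q ^ n < 1"
      using \<open>q \<ge> 1\<close> by (simp add: field_simps)
    with contra have "q \<le> B"
      by (meson not_less)
    have "inverse (real q ^ n) \<le> 1"
      using \<open>q \<ge> 1\<close> by (simp add: inverse_le_1_iff)
    with * have "\<bar>of_int p / of_nat q\<bar> \<le> \<bar>a\<bar> + 1"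
      by linarith
    then have "\<bar>of_int p\<bar> \<le> (\<bar>a\<bar> + 1) * of_nat q"
      using \<open>q \<ge> 1\<close> by (simp add: abs_divide pos_divide_le_eq)
    also have "\<dots> \<le> (\<bar>a\<bar> + 1) * of_nat B"
      using \<open>q \<le> B\<close> by (intro mult_left_mono) auto
    finally have "\<bar>p\<bar> \<le> ?K"
      by linarith
    then show ?thesis using \<open>q \<le> B\<close> by auto
  qed
  then have "{(p::int, q::nat). q \<ge> 1 \<and> \<bar>a - of_int p / of_nat q\<bar> < of_nat q powr (- \<nu>)}
      \<subseteq> {- ?K..?K} \<times> {..B}"
    by auto
  then show False
    using inf finite_subset by blast
qed

text \<open>Dependent choice: each new denominator is taken above both the required power of 2 and
  its predecessor, while the demanded exponent rises with the index.\<close>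

lemma liouville_approximating_sequence:
  assumes "liouville_number a"
  obtains p :: "nat \<Rightarrow> int" and q :: "nat \<Rightarrow> nat"
  where "strict_mono q" and "\<And>n. 2 ^ n \<le> q n"
    and "\<And>n. \<bar>a - of_int (p n) / of_nat (q n)\<bar> * of_nat (q n) ^ n < 1"
proof -
  let ?P = "\<lambda>n (p::int, q::nat). 2 ^ n \<le> q \<and> \<bar>a - of_int p / of_nat q\<bar> * of_nat q ^ n < 1"
  have "\<exists>f. \<forall>n. ?P n (f n) \<and> snd (f n) < snd (f (Suc n))"
  proof (rule dependent_nat_choice)
    show "\<exists>x. ?P 0 x"
    proof -
      obtain p q where "1 < q" "\<bar>a - of_int p / of_nat q\<bar> * of_nat q ^ 0 < 1"
        using liouville_approximation[OF assms] by blast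
      then show ?thesis
        by (intro exI[of _ "(p, q)"]) auto
    qed
    show "\<exists>y. ?P (Suc n) y \<and> snd x < snd y" for x n
    proof -
      obtain p q where "max (2 ^ Suc n) (snd x) < q"
        "\<bar>a - of_int p / of_nat q\<bar> * of_nat q ^ Suc n < 1"
        using liouville_approximation[OF assms] by blast
      then show ?thesis
        by (intro exI[of _ "(p, q)"]) auto
    qed
  qed
  then obtain f where "\<forall>n. ?P n (f n) \<and> snd (f n) < snd (f (Suc n))"
    by (rule exE)
  then show thesis
    by (intro that[of "snd \<circ> f" "fst \<circ> f"]) (auto simp: strict_mono_Suc_iff case_prod_unfold)
qed

section \<open>Lower bounds for the mixed Sobolev sum\<close>

text \<open>The sign of \<open>k\<close> is unknown. As \<open>y >= 1\<close>, the worst exponent is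
  -2m, and there replacing \<open>y\<close> by the larger \<open>C\<close> only lowers the
  power.\<close>

lemma powr_ge_inverse_power:
  fixes y k C :: real
  assumes "1 \<le> y" "y \<le> C" "\<bar>k\<bar> \<le> real m"
  shows "1 / C ^ (2 * m) \<le> y powr (2 * k)"
proof -
  have "1 / C ^ (2 * m) \<le> 1 / y ^ (2 * m)"
    using assms by (intro divide_left_mono power_mono) auto
  also have "\<dots> = y powr (- real (2 * m))"
    using assms by (simp only: powr_minus powr_realpow inverse_eq_divide)
  also have "\<dots> \<le> y powr (2 * k)"
    using assms by (intro powr_mono) auto
  finally show ?thesis .
qed

lemma japanese_bounds: "1 \<le> japanese w" "japanese w \<le> 1 + \<bar>w\<bar>"
proof -
  have eq: "japanese w = sqrt (1 + w\<^sup>2)"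
    by (simp add: japanese_def powr_half_sqrt)
  show "1 \<le> japanese w"
    by (simp add: eq)
  show "japanese w \<le> 1 + \<bar>w\<bar>"
    unfolding eq by (rule real_le_lsqrt) (auto simp: power2_eq_square algebra_simps)
qed

text \<open>Each of the two weights is at least (K q_n)^(-2m); the squared coefficient q_n^(4m)
  cancels the powers of q_n exactly and leaves K^(-4m). Terms bounded below along an injective
  sequence of frequencies exclude summability, whatever the other coefficients are.\<close>

lemma character_expansion_notin_H_mix:
  fixes p :: "nat \<Rightarrow> int" and q :: "nat \<Rightarrow> nat"
  assumes "strict_mono q" "\<And>n. 0 < q n" and p_le: "\<And>n. \<bar>real_of_int (p n)\<bar> \<le> C * real (q n)"
    and "\<bar>k1\<bar> \<le> real m" "\<bar>k2\<bar> \<le> real m" and coeff: "\<And>n. fourier_coeff u (p n) (int (q n)) = of_nat (q n) ^ (2 * m)"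
  shows "u \<notin> H_mix k1 k2"
proof
  define g where "g = (\<lambda>(\<tau>, \<xi>). japanese (of_int \<tau>) powr (2 * k1) * japanese (of_int \<xi>) powr (2 * k2)
        * (cmod (fourier_coeff u \<tau> \<xi>))^2)"
  \<comment> \<open>Since 1 <= q_n, 1 + |p_n| <= (C + 1) q_n and 1 + q_n <= 2 q_n; with
    \<open>C\<close> nonnegative, \<open>C + 2\<close> covers both.\<close>
  define K where "K = C + 2"
  have q_ge1: "1 \<le> real (q n)" for n
    using assms(2)[of n] by simp
  have "0 \<le> C"
    using order_trans[OF abs_ge_zero p_le[of 0]] q_ge1[of 0] by (simp add: zero_le_mult_iff)
  then have "K > 0" by (simp add: K_def)
  have lower: "1 / K ^ (4 * m) \<le> g (p n, int (q n))" for n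
  proof -
    have "real (q n) \<le> real (q n) + C * real (q n)"
      using \<open>0 \<le> C\<close> by simp
    then have J: "japanese (real_of_int (p n)) \<le> K * q n" "japanese (real_of_int (int (q n))) \<le> K * q n"
      using japanese_bounds(2)[of "of_int (p n)"] japanese_bounds(2)[of "real (q n)"] p_le[of n] q_ge1[of n]
      by (simp_all add: K_def algebra_simps)
    have "1 / K ^ (4 * m) = 1 / (K * q n) ^ (2 * m) * (1 / (K * q n) ^ (2 * m)) * (real (q n) ^ (2 * m))\<^sup>2"
    proof -
      have "K ^ (4 * m) = K ^ (2 * m) * K ^ (2 * m)"
        by (simp flip: power_add)
      then show ?thesis
        using assms(2)[of n] \<open>K > 0\<close> by (simp add: power_mult_distrib power2_eq_square)
    qed
    also have "\<dots> \<le> japanese (of_int (p n)) powr (2 * k1) * japanese (of_int (int (q n))) powr (2 * k2)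
        * (real (q n) ^ (2 * m))\<^sup>2"
      using \<open>K > 0\<close> by (intro mult_right_mono mult_mono powr_ge_inverse_power J japanese_bounds assms) auto
    also have "\<dots> = g (p n, int (q n))"
      by (simp add: g_def coeff norm_power)
    finally show ?thesis .
  qed
  assume "u \<in> H_mix k1 k2"
  then have "g summable_on UNIV"
    by (simp add: H_mix_def g_def)
  then have "g summable_on range (\<lambda>n. (p n, int (q n)))"
    using summable_on_subset_banach by blast
  moreover have "inj (\<lambda>n. (p n, int (q n)))"
    using strict_mono_imp_inj_on[OF assms(1)] by (auto simp: inj_def)
  ultimately have "(\<lambda>n. g (p n, int (q n))) summable_on UNIV"
    by (simp add: summable_on_reindex o_def)
  then have "(\<lambda>n. g (p n, int (q n))) \<longlonglongrightarrow> 0"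
    by (intro summable_LIMSEQ_zero summable_on_imp_summable)
  then have "1 / K ^ (4 * m) \<le> 0"
    by (rule LIMSEQ_le_const) (use lower in auto)
  then show False
    using zero_less_power[OF \<open>K > 0\<close>, of "4 * m"] by (simp add: divide_le_0_iff)
qed

section \<open>Construction of the distribution and of its smooth image\<close>

theorem proposition4p8:
  fixes a :: real
  assumes "a \<notin> \<rat>" and "liouville_number a"
  shows "\<forall>k1 k2 :: real. \<exists>f\<in>smooth_torus. \<exists>u\<in>distributions.
           distr_eq (L_op a u) (distr_of f) \<and> u \<notin> H_mix k1 k2"
proof (intro allI)
  fix k1 k2 :: real
  obtain p :: "nat \<Rightarrow> int" and q :: "nat \<Rightarrow> nat" where "strict_mono q"
    and two_pow_le: "\<And>n. 2 ^ n \<le> q n"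
    and approx: "\<And>n. \<bar>a - of_int (p n) / of_nat (q n)\<bar> * of_nat (q n) ^ n < 1"
    by (rule liouville_approximating_sequence[OF assms(2)]) (rule that)
  have q_ge1: "1 \<le> real (q n)" for n
    using order_trans[OF one_le_power two_pow_le[of n]] by simp
  have q_pos: "0 < q n" for n
    using q_ge1[of n] by (cases "q n") auto
  have inverse_q: "1 / real (q n) \<le> (1 / 2) ^ n" for n
  proof -
    have "2 ^ n \<le> real (q n)"
      using two_pow_le[of n] of_nat_mono[of "2 ^ n" "q n", where 'a = real] by simp
    then show ?thesis
      unfolding power_one_over by (rule divide_left_mono) (auto simp: q_pos)
  qed
  \<comment> \<open>Up to the factor i this is the symbol of L at (p_n, q_n). Keeping q_n^n on the
    left avoids the exponent 1 - n, which is negative for n > 1.\<close>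
  have symbol: "\<bar>of_int (p n) - a * of_nat (q n)\<bar> * of_nat (q n) ^ n \<le> of_nat (q n)" for n
  proof -
    have "of_int (p n) - a * of_nat (q n) = - ((a - of_int (p n) / of_nat (q n)) * of_nat (q n))"
      using q_pos[of n] by (simp add: left_diff_distrib)
    then have "\<bar>of_int (p n) - a * of_nat (q n)\<bar> = \<bar>a - of_int (p n) / of_nat (q n)\<bar> * of_nat (q n)"
      by (simp only: abs_minus_cancel abs_mult abs_of_nat)
    then have "\<bar>of_int (p n) - a * of_nat (q n)\<bar> * of_nat (q n) ^ n
        = (\<bar>a - of_int (p n) / of_nat (q n)\<bar> * of_nat (q n) ^ n) * of_nat (q n)"
      by simp
    also have "\<dots> \<le> 1 * of_nat (q n)"
      by (intro mult_right_mono less_imp_le approx) (simp_all add: q_pos)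
    finally show ?thesis by simp
  qed
  have p_le: "\<bar>of_int (p n)\<bar> \<le> (\<bar>a\<bar> + 1) * real (q n)" for n
  proof -
    have "\<bar>of_int (p n) - a * of_nat (q n)\<bar> \<le> \<bar>of_int (p n) - a * of_nat (q n)\<bar> * of_nat (q n) ^ n"
      using q_pos[of n] q_ge1[of n] by (simp add: mult_le_cancel_left1)
    then show ?thesis
      using symbol[of n] abs_mult[of a "real (q n)"] by (simp add: algebra_simps)
  qed
  obtain m :: nat where "max \<bar>k1\<bar> \<bar>k2\<bar> \<le> real m"
    using real_arch_simple by blast
  then have m: "\<bar>k1\<bar> \<le> real m" "\<bar>k2\<bar> \<le> real m"
    by auto
  define c :: "nat \<Rightarrow> complex" where "c = (\<lambda>n. of_nat (q n) ^ (2 * m))"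
  define D where "D = (\<lambda>n. distr_of (character (p n) (int (q n))))"
  \<comment> \<open>Outside \<open>smooth_torus\<close> the series may diverge and
    \<open>suminf\<close> then carries no meaning; equality and membership in
    \<open>distributions\<close> test smooth functions only.\<close>
  define u where "u = (\<lambda>\<phi>. \<Sum>n. c n * D n \<phi>)"
  define d :: "nat \<Rightarrow> complex" where
    "d = (\<lambda>n. \<i> * of_real (of_int (p n) - a * of_nat (q n)) * c n)"
  define f where "f = trig_series d p (\<lambda>n. int (q n))"
  have d: "rapidly_decreasing d p (\<lambda>n. int (q n))"
    unfolding rapidly_decreasing_def
  proof
    fix k
    let ?w = "\<lambda>n. 1 + \<bar>real_of_int (p n)\<bar> + \<bar>of_int (int (q n))\<bar>"
    \<comment> \<open>1 + |p_n| + q_n <= q_n + (|a| + 1) q_n + q_n, by \<open>p_le\<close> and 1 <=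
      q_n.\<close>
    let ?C = "\<bar>a\<bar> + 3"
    show "summable (\<lambda>n. cmod (d n) * ?w n ^ k)"
    proof (rule summable_comparison_test')
      show "summable (\<lambda>n. ?C ^ k * (1 / 2) ^ n)"
        by (intro summable_mult summable_geometric) simp
      \<comment> \<open>The gain q_n^n has to absorb q_n^(2m) from \<open>c\<close>, one q_n from
        \<open>symbol\<close> and q_n^k from the weight, and still leave one q_n for the geometric
        majorant. The finitely many earlier terms do not affect summability.\<close>
      show "norm (cmod (d n) * ?w n ^ k) \<le> ?C ^ k * (1 / 2) ^ n" if "2 * m + 1 + k + 1 \<le> n" for n
      proof -
        define r where "r = n - (2 * m + 1 + k + 1)"
        have n: "n = (2 * m + 1 + k) + Suc r"
          using that by (simp add: r_def)
        let ?N = "2 * m + 1 + k"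
        have "cmod (d n) * real (q n) ^ n = (\<bar>of_int (p n) - a * of_nat (q n)\<bar> * of_nat (q n) ^ n) * real (q n) ^ (2 * m)"
          by (simp add: d_def c_def norm_mult norm_power del: of_real_diff)
        also have "\<dots> \<le> real (q n) * real (q n) ^ (2 * m)"
          by (intro mult_right_mono symbol) simp
        finally have "cmod (d n) * real (q n) ^ n \<le> real (q n) ^ (2 * m + 1)"
          by simp
        moreover have "?w n ^ k \<le> (?C * q n) ^ k"
          using p_le[of n] q_ge1[of n] by (intro power_mono) (auto simp: algebra_simps)
        ultimately have "(cmod (d n) * real (q n) ^ n) * ?w n ^ k \<le> real (q n) ^ (2 * m + 1) * (?C * q n) ^ k"
          by (intro mult_mono) auto
        then have "(cmod (d n) * ?w n ^ k) * real (q n) ^ n \<le> real (q n) ^ ?N * ?C ^ k"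
          by (simp add: power_add power_mult_distrib mult_ac)
        moreover have "real (q n) ^ n = real (q n) ^ ?N * real (q n) ^ Suc r"
          by (subst (2) n) (rule power_add)
        ultimately have "real (q n) ^ ?N * ((cmod (d n) * ?w n ^ k) * real (q n) ^ Suc r) \<le> real (q n) ^ ?N * ?C ^ k"
          by (simp only: mult_ac)
        then have "(cmod (d n) * ?w n ^ k) * real (q n) ^ Suc r \<le> ?C ^ k"
          using q_pos[of n] by (simp only: mult_le_cancel_left_pos zero_less_power of_nat_0_less_iff)
        moreover have "(cmod (d n) * ?w n ^ k) * q n \<le> (cmod (d n) * ?w n ^ k) * real (q n) ^ Suc r"
          using q_ge1[of n] self_le_power[of "real (q n)" "Suc r"] by (intro mult_left_mono) auto
        ultimately have "(cmod (d n) * ?w n ^ k) * q n \<le> ?C ^ k"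
          by (rule order_trans[rotated])
        then have "cmod (d n) * ?w n ^ k \<le> ?C ^ k * (1 / q n)"
          using q_pos[of n] by (simp add: field_simps)
        also have "\<dots> \<le> ?C ^ k * (1 / 2) ^ n"
          by (intro mult_left_mono inverse_q) auto
        finally show ?thesis by simp
      qed
    qed
  qed
  \<comment> \<open>Of the 2m + 1 derivatives, 2m cancel the growth of \<open>c n\<close> and the
    last one supplies 1/q_n <= 2^(-n).\<close>
  have term_le: "cmod (c n * D n \<phi>) \<le> (2 * pi)^2 * Ck_norm (2 * m + 1) \<phi> * (1 / 2) ^ n"
    if "\<phi> \<in> smooth_torus" for n \<phi>
  proof -
    have "cmod (c n * D n \<phi>) * q n \<le> (2 * pi)^2 * Ck_norm (2 * m + 1) \<phi>"
      using norm_distr_of_character_le[OF that, of "int (q n)" "2 * m + 1" "p n"]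
      by (simp add: c_def D_def norm_mult norm_power mult_ac)
    then have *: "cmod (c n * D n \<phi>) \<le> (2 * pi)^2 * Ck_norm (2 * m + 1) \<phi> * (1 / q n)"
      using q_pos[of n] by (simp add: field_simps)
    moreover have "0 \<le> Ck_norm (2 * m + 1) \<phi>"
      using norm_partial_x_le_Ck_norm[OF that] norm_ge_zero order_trans by blast
    then have "(2 * pi)^2 * Ck_norm (2 * m + 1) \<phi> * (1 / q n)
        \<le> (2 * pi)^2 * Ck_norm (2 * m + 1) \<phi> * (1 / 2) ^ n"
      by (intro mult_left_mono inverse_q) auto
    ultimately show ?thesis by linarith
  qed
  have majorant: "summable (\<lambda>n. B * (1 / 2 :: real) ^ n)" for B
    by (intro summable_mult summable_geometric) simp
  have summable: "summable (\<lambda>n. c n * D n \<phi>)" if "\<phi> \<in> smooth_torus" for \<phi>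
    by (rule summable_comparison_test'[OF majorant term_le[OF that]])
  have "u \<in> distributions"
    unfolding distributions_def
  proof (intro CollectI conjI ballI allI exI)
    show "u (\<lambda>z. \<phi> z + \<psi> z) = u \<phi> + u \<psi>" if "\<phi> \<in> smooth_torus" "\<psi> \<in> smooth_torus" for \<phi> \<psi>
      using that by (simp add: u_def D_def distr_of_add character_smooth distrib_left
          suminf_add summable[unfolded D_def])
    show "u (\<lambda>z. b * \<phi> z) = b * u \<phi>" if "\<phi> \<in> smooth_torus" for b \<phi>
      using suminf_mult[OF summable[OF that], of b]
      by (simp add: u_def D_def distr_of_cmult mult_ac)
    \<comment> \<open>This fixes the constant and the order of continuity; the leading 2 is the sum
      of the geometric series.\<close>
    show "cmod (u \<phi>) \<le> 2 * (2 * pi)^2 * Ck_norm (2 * m + 1) \<phi>" if "\<phi> \<in> smooth_torus" for \<phi>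
    proof -
      have "cmod (u \<phi>) \<le> (\<Sum>n. (2 * pi)^2 * Ck_norm (2 * m + 1) \<phi> * (1 / 2) ^ n)"
        unfolding u_def by (rule norm_suminf_le[OF term_le[OF that] majorant])
      also have "\<dots> = (2 * pi)^2 * Ck_norm (2 * m + 1) \<phi> * 2"
        using suminf_mult[of "\<lambda>n. (1 / 2 :: real) ^ n" "(2 * pi)^2 * Ck_norm (2 * m + 1) \<phi>"]
          suminf_geometric[of "1 / 2 :: real"] summable_geometric[of "1 / 2 :: real"]
        by simp
      finally show ?thesis by (simp only: mult_ac)
    qed
  qed
  moreover have "distr_eq (L_op a u) (distr_of f)"
    unfolding distr_eq_def
  proof
    fix \<phi> assume \<phi>: "\<phi> \<in> smooth_torus"
    have "L_op a u \<phi> = of_real a * u (partial_x \<phi>) - u (partial_t \<phi>)"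
      by (simp add: L_op_def distr_partial_t_def distr_partial_x_def)
    also have "\<dots> = (\<Sum>n. of_real a * (c n * D n (partial_x \<phi>)) - c n * D n (partial_t \<phi>))"
      using suminf_mult[OF summable[OF smooth_torus_partial(2)[OF \<phi>]], of "of_real a"]
        suminf_diff[OF summable_mult[OF summable[OF smooth_torus_partial(2)[OF \<phi>]], of "of_real a"]
          summable[OF smooth_torus_partial(1)[OF \<phi>]]]
      by (simp add: u_def)
    \<comment> \<open>The derivatives contribute -i p_n and -i q_n, so the combination is i (p_n - a
      q_n) \<open>c n\<close>, which is \<open>d n\<close>.\<close>
    also have "\<dots> = (\<Sum>n. d n * D n \<phi>)"
      by (simp add: D_def d_def distr_of_character_partial[OF \<phi>] algebra_simps)
    also have "\<dots> = distr_of f \<phi>"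
      using distr_of_trig_series[OF d \<phi>] by (simp add: f_def D_def)
    finally show "L_op a u \<phi> = distr_of f \<phi>" .
  qed
  moreover have "u \<notin> H_mix k1 k2"
  proof (rule character_expansion_notin_H_mix[OF \<open>strict_mono q\<close> q_pos p_le m])
    fix n
    \<comment> \<open>The coefficient at (p_n, q_n) tests against the opposite frequency, and
      injectivity of \<open>q\<close> leaves \<open>j = n\<close> as the only index that
      responds.\<close>
    have "D j (character (- p n) (- int (q n))) = (if j = n then (2 * of_real pi)^2 else 0)" for j
      using strict_mono_eq[OF \<open>strict_mono q\<close>, of j n] by (auto simp: D_def distr_of_characters)
    then have "u (character (- p n) (- int (q n))) = c n * (2 * of_real pi)^2"
      unfolding u_def using suminf_finite[of "{n}" "\<lambda>j. c j * D j (character (- p n) (- int (q n)))"] by simp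
    moreover have "(\<lambda>(t, x). exp (- \<i> * of_real (t * of_int (p n) + x * of_int (int (q n)))))
        = character (- p n) (- int (q n))"
      by (auto simp: character_def fun_eq_iff algebra_simps)
    ultimately show "fourier_coeff u (p n) (int (q n)) = of_nat (q n) ^ (2 * m)"
      unfolding fourier_coeff_def by (simp add: c_def)
  qed
  moreover have "f \<in> smooth_torus"
    unfolding f_def by (rule trig_series_smooth[OF d])
  ultimately show "\<exists>f\<in>smooth_torus. \<exists>u\<in>distributions.
      distr_eq (L_op a u) (distr_of f) \<and> u \<notin> H_mix k1 k2"
    by blast
qed

end
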